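(* Let $s$ be a positive integer and let $F:\mathbb{Z}_{\geq 0}^s\to\mathbb{Z}_{\geq 0}$ be monotonically increasing. For each $i\in\{1,\dots,s\}$ and each fixed choice of $x_1,\dots,x_{i-1},x_{i+1},\dots,x_s\in\mathbb{Z}_{\geq 0}$, let $g_{x_1,\dots,x_{i-1},x_{i+1},\dots,x_s}:\mathbb{Z}_{\geq 0}\to\mathbb{Z}_{\geq 0}$ be the one-variable function $g_{x_1,\dots,x_{i-1},x_{i+1},\dots,x_s}(x_i)=F(x_1,x_2,\dots,x_s)$. Suppose that for every $i\in\{1,\dots,s\}$ and every fixed $x_1,\dots,x_{i-1},x_{i+1},\dots,x_s\in\mathbb{Z}_{\geq 0}$, the function $g_{x_1,\dots,x_{i-1},x_{i+1},\dots,x_s}$ has the NS property. Then for all $x_1,\dots,x_s,y\in\mathbb{Z}_{\geq 0}$ with $y\leq F(x_1,\dots,x_s)$, the Grundy number of the chocolate bar $CB(F,x_1,\dots,x_s,y)$ is $$\mathcal{G}(\{x_1,x_2,\dots,x_s,y\})=x_1\oplus x_2\oplus\cdots\oplus x_s\oplus y.$$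
   Context: $\oplus$ denotes nim-sum (bitwise XOR of nonnegative integers). Monotonicity: $F:\mathbb{Z}_{\geq 0}^s\to\mathbb{Z}_{\geq 0}$ is monotonically increasing if $F(x_1,\dots,x_s)\leq F(x_1',\dots,x_s')$ whenever $x_i\leq x_i'$ for all $i=1,\dots,s$. For $s=1$ this is the usual notion of a (weakly) monotonically increasing function. NS property: a monotonically increasing function $h:\mathbb{Z}_{\geq 0}\to\mathbb{Z}_{\geq 0}$ has the NS property if, for all $z,z'\in\mathbb{Z}_{\geq 0}$ and every integer $i\geq 1$, $\lfloor z/2^i\rfloor=\lfloor z'/2^i\rfloor$ implies $\lfloor h(z)/2^{i-1}\rfloor=\lfloor h(z')/2^{i-1}\rfloor$. Chocolate bar: for a fixed monotonically increasing $F$, the $(s+1)$-dimensional chocolate bar $CB(F,x_1,\dots,x_s,y)$ consists of unit boxes; for each $(u_1,\dots,u_s)$ with $0\leq u_i\leq x_i$, the column at position $(u_1,\dots,u_s)$ has length $\min(F(u_1,\dots,u_s),y)+1$ in the $(s+1)$-th direction. The box at the bottom of the column at $(0,\dots,0)$ is bitter. Players alternately cut the bar along a groove by a hyperplane perpendicular to one of the $s+1$ coordinate axes and eat the piece not containing the bitter box; the player who leaves the opponent with the single bitter box wins. The bar is represented by its coordinates $\{x_1,\dots,x_s,y\}$ (an ordered tuple), which count the grooves of the bar in each direction, so positions are tuples with $y\leq F(x_1,\dots,x_s)$. Moves: the set of positions reachable in one move from $\{x_1,\dots,x_s,y\}$ is $$move_F(\{x_1,\dots,x_s,y\})=\bigcup_{i=1}^{s}\big\{\{x_1,\dots,x_{i-1},u,x_{i+1},\dots,x_s,\min(F(x_1,\dots,x_{i-1},u,x_{i+1},\dots,x_s),y)\}:u\in\mathbb{Z}_{\geq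 0},\,u<x_i\big\}\cup\big\{\{x_1,\dots,x_s,w\}:w\in\mathbb{Z}_{\geq 0},\,w<y\big\}.$$ Grundy number: $\mathcal{G}(\mathbf{p})=\mathrm{mex}\{\mathcal{G}(\mathbf{q}):\mathbf{q}\in move_F(\mathbf{p})\}$, where $\mathrm{mex}(S)$ is the least nonnegative integer not in $S$. *)

theory Defs
  imports Main
begin

text \<open>
  An \<open>s\<close>-tuple of nonnegative integers is a list of length \<open>s\<close>, with coordinates indexed from \<open>0\<close>.
  A function of \<open>s\<close> variables is a function on lists of which only the values on lists of
  length \<open>s\<close> are relevant.
\<close>

definition tuples :: "nat \<Rightarrow> nat list set" where
  "tuples s = {xs. length xs = s}"

definition mono_increasing :: "nat \<Rightarrow> (nat list \<Rightarrow> nat) \<Rightarrow> bool" where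
  "mono_increasing s F \<longleftrightarrow> monotone_on (tuples s) (list_all2 (\<le>)) (\<le>) F"

definition NS_property :: "(nat \<Rightarrow> nat) \<Rightarrow> bool" where
  "NS_property h \<longleftrightarrow> mono h \<and>
     (\<forall>z z' i. i \<ge> 1 \<longrightarrow> z div 2 ^ i = z' div 2 ^ i \<longrightarrow> h z div 2 ^ (i - 1) = h z' div 2 ^ (i - 1))"

text \<open>
  The function of the \<open>i\<close>-th variable obtained from \<open>F\<close> by fixing the other entries of \<open>xs\<close>;
  it does not depend on the entry \<open>xs ! i\<close>.
\<close>

definition coord_slice :: "(nat list \<Rightarrow> nat) \<Rightarrow> nat list \<Rightarrow> nat \<Rightarrow> nat \<Rightarrow> nat" where
  "coord_slice F xs i = (\<lambda>t. F (xs[i := t]))"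

text \<open>
  A position \<open>(xs, y)\<close> stands for the chocolate bar whose column at \<open>us\<close>, with \<open>us\<close> bounded by
  \<open>xs\<close> coordinatewise, has length \<open>min (F us) y + 1\<close>; \<open>xs\<close> and \<open>y\<close> count the grooves in each
  direction, which requires \<open>y \<le> F xs\<close>.  A cut across the \<open>i\<close>-th axis can lower the height, whence
  the minimum in \<open>moves\<close>.
\<close>

type_synonym position = "nat list \<times> nat"

definition moves :: "(nat list \<Rightarrow> nat) \<Rightarrow> position \<Rightarrow> position set" where
  "moves F = (\<lambda>(xs, y).
     (\<Union>i<length xs. {(xs[i := u], min (F (xs[i := u])) y) | u. u < xs ! i})
     \<union> {(xs, w) | w. w < y})"

definition mex :: "nat set \<Rightarrow> nat" where
  "mex S = (LEAST n. n \<notin> S)"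

lemma moves_decrease:
  assumes "q \<in> moves F p"
  shows "sum_list (fst q) + snd q < sum_list (fst p) + snd p"
proof -
  have less: "sum_list (xs[i := u]) < sum_list xs"
    if "i < length xs" "u < xs ! i" for xs :: "nat list" and i u
    using that
  proof (induction xs arbitrary: i)
    case (Cons a xs)
    then show ?case by (cases i) auto
  qed simp
  show ?thesis
    using assms by (cases p) (auto simp: moves_def dest: less intro: add_less_le_mono)
qed

function grundy :: "(nat list \<Rightarrow> nat) \<Rightarrow> position \<Rightarrow> nat" where
  "grundy F p = mex (grundy F ` moves F p)"
  by auto
termination
  by (relation "measure (\<lambda>(F, p). sum_list (fst p) + snd p)") (auto dest: moves_decrease)

text \<open>The equation for \<^const>\<open>grundy\<close> is unconditional, so it loops as a rewrite rule.\<close>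
declare grundy.simps [simp del]

definition nim_sum :: "nat list \<Rightarrow> nat" where
  "nim_sum xs = foldr xor xs 0"

end

theory Submission imports Defs begin

text \<open>
  For a function \<open>h\<close> with the NS property, the bits of \<open>h u\<close> from position \<open>j\<close> on are determined by
  the bits of \<open>u\<close> from position \<open>j + 1\<close> on.  Hence \<open>u \<mapsto> u \<oplus> h u\<close> is injective (look at the top bit
  in which two arguments differ), and \<open>u \<oplus> h u = t\<close> can be solved by choosing the bits of \<open>u\<close> from
  the top down.  The NS property survives \<open>h \<mapsto> min h y\<close>, so with \<open>h u = min (F (xs[i := u])) y\<close>
  injectivity shows that a cut across the axis \<open>i\<close> changes the nim-sum, and solvability supplies the
  cuts that Bouton's strategy for Nim asks for.
\<close>

section \<open>Binary digits and the order on naturals\<close>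

lemma drop_bit_rec_nat:
  "drop_bit k (a::nat) = of_bool (bit a k) + 2 * drop_bit (Suc k) a"
  by (simp add: bit_iff_odd_drop_bit drop_bit_Suc drop_bit_half)

lemma drop_bit_eq_iff_nat:
  "drop_bit k (a::nat) = drop_bit k b \<longleftrightarrow>
    (bit a k \<longleftrightarrow> bit b k) \<and> drop_bit (Suc k) a = drop_bit (Suc k) b"
proof
  assume "drop_bit k a = drop_bit k b"
  then show "(bit a k \<longleftrightarrow> bit b k) \<and> drop_bit (Suc k) a = drop_bit (Suc k) b"
    by (metis bit_iff_odd_drop_bit drop_bit_Suc drop_bit_half)
qed (simp add: drop_bit_rec_nat[of k])

lemma top_differing_bit:
  fixes a b :: nat
  assumes "a \<noteq> b"
  obtains k where "drop_bit (Suc k) a = drop_bit (Suc k) b" "bit a k \<noteq> bit b k"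
proof -
  \<comment> \<open>Both truncations vanish at \<open>a + b\<close>, so a least agreeing
    \<open>n\<close> exists; it is positive, and \<open>k\<close> is its predecessor.\<close>
  define P where "P n \<longleftrightarrow> drop_bit n a = drop_bit n b" for n
  have "a < 2 ^ (a + b)" "b < 2 ^ (a + b)"
    using less_exp[of "a + b"] by linarith+
  then have "P (a + b)"
    by (simp add: P_def drop_bit_eq_div)
  moreover have "\<not> P 0"
    using assms by (simp add: P_def)
  ultimately obtain k where "\<not> P k" "P (Suc k)"
    using ex_least_nat_less[of P "a + b"] by blast
  then show thesis
    using that drop_bit_eq_iff_nat[of k a b] unfolding P_def by blast
qed

lemma less_if_top_bit:
  fixes a b :: nat
  assumes "drop_bit (Suc k) a = drop_bit (Suc k) b" "\<not> bit a k" "bit b k"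
  shows "a < b"
proof -
  have "drop_bit k a < drop_bit k b"
    using assms by (simp add: drop_bit_rec_nat[of k])
  then show ?thesis
    by (metis div_le_mono drop_bit_eq_div linorder_not_less)
qed

lemma less_top_bit:
  fixes a b :: nat
  assumes "a < b"
  obtains k where "drop_bit (Suc k) a = drop_bit (Suc k) b" "\<not> bit a k" "bit b k"
proof -
  obtain k where k: "drop_bit (Suc k) a = drop_bit (Suc k) b" "bit a k \<noteq> bit b k"
    using assms by (metis less_irrefl top_differing_bit)
  then show thesis
    using that assms less_if_top_bit[of k b a] by fastforce
qed

text \<open>Division by \<open>2 ^ k\<close> is monotone, hence commutes with \<open>min\<close>;
  capping at \<open>y\<close> thus preserves \<open>NS_bits\<close>.\<close>

lemma drop_bit_min_nat: "drop_bit k (min a b) = min (drop_bit k a) (drop_bit k (b::nat))"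
  by (metis div_le_mono drop_bit_eq_div linorder_linear min_def min.absorb2)

section \<open>The NS property in terms of bits\<close>

definition NS_bits :: "(nat \<Rightarrow> nat) \<Rightarrow> bool" where
  "NS_bits h \<longleftrightarrow> (\<forall>k z z'. drop_bit (Suc k) z = drop_bit (Suc k) z' \<longrightarrow>
     drop_bit k (h z) = drop_bit k (h z'))"

lemma NS_bitsD:
  "NS_bits h \<Longrightarrow> drop_bit (Suc k) z = drop_bit (Suc k) z' \<Longrightarrow>
    drop_bit k (h z) = drop_bit k (h z')"
  unfolding NS_bits_def by blast

lemma NS_property_imp_NS_bits:
  assumes "NS_property h"
  shows "NS_bits h"
  unfolding NS_bits_def
proof (intro allI impI)
  fix k z z' :: nat
  assume "drop_bit (Suc k) z = drop_bit (Suc k) z'"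
  then have "z div 2 ^ Suc k = z' div 2 ^ Suc k"
    by (simp only: drop_bit_eq_div)
  moreover have "Suc k \<ge> 1" "Suc k - 1 = k"
    by simp_all
  ultimately show "drop_bit k (h z) = drop_bit k (h z')"
    using assms unfolding NS_property_def drop_bit_eq_div by metis
qed

lemma NS_bits_min: "NS_bits h \<Longrightarrow> NS_bits (\<lambda>u. min (h u) y)"
  unfolding NS_bits_def drop_bit_min_nat by metis

lemma NS_bits_xor_inj:
  assumes "NS_bits h" "xor u (h u) = xor u' (h u')"
  shows "u = u'"
proof (rule ccontr)
  assume "u \<noteq> u'"
  then obtain k where k: "drop_bit (Suc k) u = drop_bit (Suc k) u'" "bit u k \<noteq> bit u' k"
    by (rule top_differing_bit)
  have "bit (h u) k = bit (h u') k"
    using NS_bitsD[OF assms(1) k(1)] by (simp only: drop_bit_eq_iff_nat[of k])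
  then show False
    using k(2) assms(2) by (metis bit_xor_iff)
qed

text \<open>Induction on the number \<open>k\<close> of low bits still to be fixed. The bits of
  \<open>u\<close> from \<open>k\<close> on are kept so that callers can compare \<open>u'\<close>
  with other numbers.\<close>

lemma NS_bits_xor_solve:
  assumes "NS_bits h" "drop_bit k (xor u (h u)) = drop_bit k t"
  obtains u' where "drop_bit k u' = drop_bit k u" "xor u' (h u') = t"
proof -
  have "\<exists>u'. drop_bit k u' = drop_bit k u \<and> xor u' (h u') = t"
    using assms(2)
  proof (induction k arbitrary: u)
    case (Suc k)
    \<comment> \<open>Flip bit \<open>k\<close> of \<open>u\<close> exactly when that bit of the xor
      is wrong. The value of \<open>h\<close> cannot spoil this: its bits from \<open>k\<close> on
      depend only on bits above \<open>k\<close>.\<close>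
    define v where "v = (if bit (xor u (h u)) k = bit t k then u else xor u (2 ^ k))"
    have v: "drop_bit (Suc k) v = drop_bit (Suc k) u"
      by (simp add: v_def drop_bit_xor) (simp add: drop_bit_eq_div)
    have h: "drop_bit k (h v) = drop_bit k (h u)"
      using NS_bitsD[OF assms(1) v] .
    have "drop_bit (Suc k) (xor v (h v)) = drop_bit (Suc k) t"
      using Suc.prems v h by (simp only: drop_bit_xor drop_bit_eq_iff_nat[of k])
    moreover have "bit (xor v (h v)) k = bit t k"
    proof -
      have "bit (h v) k = bit (h u) k"
        using h by (simp only: drop_bit_eq_iff_nat[of k])
      then show ?thesis
        by (auto simp: v_def bit_xor_iff bit_exp_iff split: if_splits)
    qed
    ultimately have "drop_bit k (xor v (h v)) = drop_bit k t"
      by (simp only: drop_bit_eq_iff_nat[of k])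
    from Suc.IH[OF this] show ?case
      using v by (metis drop_bit_eq_iff_nat)
  qed auto
  then show thesis
    using that by blast
qed

section \<open>Nim-sums and mex\<close>

lemma xor_self_left: "xor a (xor a b) = (b::nat)"
  by (simp add: xor.assoc[symmetric])

lemma xor_left_cancel: "xor a b = xor a c \<longleftrightarrow> b = (c::nat)"
  by (metis xor_self_left)

lemma nim_sum_snoc: "nim_sum (xs @ [y]) = xor (nim_sum xs) y"
  by (induction xs) (simp_all add: nim_sum_def ac_simps)

lemma nim_sum_update:
  "i < length xs \<Longrightarrow> nim_sum (xs[i := u]) = xor (xor (nim_sum xs) (xs ! i)) u"
proof (induction xs arbitrary: i)
  case (Cons a xs)
  then show ?case
    by (cases i) (auto simp: nim_sum_def ac_simps xor_self_left)
qed simp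

lemma bit_nim_sumE:
  assumes "bit (nim_sum xs) k"
  obtains i where "i < length xs" "bit (xs ! i) k"
proof -
  have "\<exists>x\<in>set xs. bit x k"
    using assms by (induction xs) (auto simp: nim_sum_def bit_xor_iff)
  then show thesis
    using that by (auto simp: in_set_conv_nth)
qed

lemma mex_eqI:
  assumes "n \<notin> S" "\<And>v. v < n \<Longrightarrow> v \<in> S"
  shows "mex S = n"
  unfolding mex_def using assms by (intro Least_equality) (auto simp: not_less[symmetric])

section \<open>Effect of moves on the nim-sum\<close>

lemma moves_cases:
  assumes "q \<in> moves F (xs, y)"
  obtains (cut) i u where "i < length xs" "u < xs ! i" "q = (xs[i := u], min (F (xs[i := u])) y)"
    | (top) w where "w < y" "q = (xs, w)"
  using assms unfolding moves_def by auto

lemma nim_sum_move_neq: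
  assumes NS: "\<And>i. i < length xs \<Longrightarrow> NS_bits (coord_slice F xs i)"
    and "y \<le> F xs" "q \<in> moves F (xs, y)"
  shows "nim_sum (fst q @ [snd q]) \<noteq> nim_sum (xs @ [y])"
  using assms(3)
proof (cases rule: moves_cases)
  case (cut i u)
  \<comment> \<open>Since \<open>y \<le> F xs\<close>, the position before the cut also lies on the
    graph of the capped slice, so injectivity compares it with the position after the cut.\<close>
  define h where "h u = min (coord_slice F xs i u) y" for u
  have h: "h u = min (F (xs[i := u])) y" "h (xs ! i) = y"
    using assms(2) by (simp_all add: h_def coord_slice_def)
  have "NS_bits h"
    unfolding h_def by (rule NS_bits_min[OF NS[OF cut(1)]])
  from NS_bits_xor_inj[OF this, of u "xs ! i"] have "xor u (h u) \<noteq> xor (xs ! i) y"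
    using cut(2) h(2) by auto
  moreover have "nim_sum (fst q @ [snd q]) = xor (xor (nim_sum xs) (xs ! i)) (xor u (h u))"
    using cut h(1) by (simp add: nim_sum_snoc nim_sum_update xor.assoc)
  moreover have "nim_sum (xs @ [y]) = xor (xor (nim_sum xs) (xs ! i)) (xor (xs ! i) y)"
    by (simp add: nim_sum_snoc xor.assoc xor_self_left)
  ultimately show ?thesis
    by (simp add: xor_left_cancel)
next
  case (top w)
  then show ?thesis
    by (simp add: nim_sum_snoc xor_left_cancel)
qed

lemma nim_sum_move_ex:
  assumes NS: "\<And>i. i < length xs \<Longrightarrow> NS_bits (coord_slice F xs i)"
    and "y \<le> F xs" "v < nim_sum (xs @ [y])"
  obtains q where "q \<in> moves F (xs, y)" "nim_sum (fst q @ [snd q]) = v"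
proof -
  define N where "N = nim_sum (xs @ [y])"
  obtain k where k: "drop_bit (Suc k) v = drop_bit (Suc k) N" "\<not> bit v k" "bit N k"
    using assms(3) unfolding N_def by (rule less_top_bit)
  have N: "N = xor (nim_sum xs) y"
    by (simp add: N_def nim_sum_snoc)
  show thesis
  proof (cases "bit y k")
    case True
    \<comment> \<open>\<open>xor v N\<close> marks the bits to be changed. Its top bit is
      \<open>k\<close>, which is set in \<open>y\<close>, so the change lowers
      \<open>y\<close>.\<close>
    define w where "w = xor y (xor v N)"
    have "w < y"
    proof (rule less_if_top_bit)
      show "drop_bit (Suc k) w = drop_bit (Suc k) y"
        using k(1) by (simp only: w_def drop_bit_xor) simp
    qed (use k True in \<open>simp_all add: w_def bit_xor_iff\<close>)
    then have "(xs, w) \<in> moves F (xs, y)"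
      by (simp add: moves_def)
    moreover have "xor (nim_sum xs) w = v"
      by (simp add: w_def N bit_eq_iff bit_xor_iff) blast
    ultimately show thesis
      using that by (simp add: nim_sum_snoc)
  next
    case False
    then have "bit (nim_sum xs) k"
      using k(3) by (simp add: N bit_xor_iff)
    then obtain i where i: "i < length xs" "bit (xs ! i) k"
      by (rule bit_nim_sumE)
    define h where "h u = min (coord_slice F xs i u) y" for u
    have h: "h u = min (F (xs[i := u])) y" "h (xs ! i) = y" for u
      using assms(2) by (simp_all add: h_def coord_slice_def)
    have NSh: "NS_bits h"
      unfolding h_def by (rule NS_bits_min[OF NS[OF i(1)]])
    \<comment> \<open>\<open>t\<close> is what entry \<open>i\<close> and the height must contribute
      together for the nim-sum to be \<open>v\<close>.\<close>
    define t where "t = xor (xor (xs ! i) y) (xor v N)"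
    \<comment> \<open>Clearing bit \<open>k\<close> makes every \<open>u\<close> that agrees with
      \<open>u0\<close> from bit \<open>k\<close> on smaller than \<open>xs ! i\<close>; the bits
      below \<open>k\<close> stay free for solving.\<close>
    define u0 where "u0 = xor (xs ! i) (2 ^ k)"
    have u0: "drop_bit (Suc k) u0 = drop_bit (Suc k) (xs ! i)" "\<not> bit u0 k"
      using i(2) by (simp_all add: u0_def drop_bit_xor bit_xor_iff bit_exp_iff)
        (simp add: drop_bit_eq_div)
    have hu0: "drop_bit k (h u0) = drop_bit k y"
      using NS_bitsD[OF NSh u0(1)] h(2) by simp
    have "drop_bit (Suc k) (xor u0 (h u0)) = drop_bit (Suc k) t"
      using hu0 u0(1) k(1) by (simp only: t_def drop_bit_xor drop_bit_eq_iff_nat[of k]) simp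
    \<comment> \<open>Both sides equal bit \<open>k\<close> of \<open>y\<close>: on the left
      \<open>u0\<close> has a 0 there, on the right the 1 of \<open>xs ! i\<close> cancels against
      that of \<open>xor v N\<close>.\<close>
    moreover have "bit (xor u0 (h u0)) k = bit t k"
      using hu0 u0(2) k i(2) by (simp add: t_def drop_bit_eq_iff_nat[of k] bit_xor_iff)
    ultimately have "drop_bit k (xor u0 (h u0)) = drop_bit k t"
      by (simp only: drop_bit_eq_iff_nat[of k])
    then obtain u where u: "drop_bit k u = drop_bit k u0" "xor u (h u) = t"
      by (rule NS_bits_xor_solve[OF NSh])
    have "u < xs ! i"
      using u(1) u0 i(2) by (intro less_if_top_bit) (auto simp: drop_bit_eq_iff_nat[of k])
    then have "(xs[i := u], h u) \<in> moves F (xs, y)"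
      using i(1) unfolding moves_def h(1) by blast
    moreover have "nim_sum (xs[i := u] @ [h u]) = v"
    proof -
      have "nim_sum (xs[i := u] @ [h u]) = xor (xor (nim_sum xs) (xs ! i)) t"
        using i(1) by (simp add: nim_sum_snoc nim_sum_update u(2)[symmetric] xor.assoc)
      also have "\<dots> = v"
        by (simp add: t_def N bit_eq_iff bit_xor_iff) blast
      finally show ?thesis .
    qed
    ultimately show thesis
      using that by simp
  qed
qed

text \<open>Ensures that the induction hypothesis of the theorem applies to every option.\<close>

lemma moves_valid:
  assumes "y \<le> F xs" "q \<in> moves F (xs, y)"
  shows "length (fst q) = length xs" "snd q \<le> F (fst q)"
  using assms(2,1) by (cases rule: moves_cases; simp)+

theorem theorem5:
  fixes s :: nat and F :: "nat list \<Rightarrow> nat" and xs :: "nat list" and y :: nat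
  assumes "s \<ge> 1"
    and "mono_increasing s F"
    and "\<And>i zs. i < s \<Longrightarrow> zs \<in> tuples s \<Longrightarrow> NS_property (coord_slice F zs i)"
    and "xs \<in> tuples s"
    and "y \<le> F xs"
  shows "grundy F (xs, y) = nim_sum (xs @ [y])"
  using assms(4,5)
\<comment> \<open>The induction uses the total that makes \<open>grundy\<close> terminate.\<close>
proof (induction "sum_list xs + y" arbitrary: xs y rule: less_induct)
  case less
  have NS: "NS_bits (coord_slice F xs i)" if "i < length xs" for i
    using assms(3) less.prems(1) that by (auto simp: tuples_def intro: NS_property_imp_NS_bits)
  have IH: "grundy F q = nim_sum (fst q @ [snd q])" if "q \<in> moves F (xs, y)" for q
    using less.hyps[of "fst q" "snd q"] moves_decrease[OF that] moves_valid[of y F xs q]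
      less.prems that by (simp add: tuples_def)
  have "mex (grundy F ` moves F (xs, y)) = nim_sum (xs @ [y])"
  proof (rule mex_eqI)
    show "nim_sum (xs @ [y]) \<notin> grundy F ` moves F (xs, y)"
      using IH nim_sum_move_neq[OF NS less.prems(2)] by fastforce
    show "v \<in> grundy F ` moves F (xs, y)" if "v < nim_sum (xs @ [y])" for v
      using nim_sum_move_ex[OF NS less.prems(2) that] IH by (metis image_eqI)
  qed
  then show ?case
    by (simp add: grundy.simps[of F "(xs, y)"])
qed

end
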